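(* For each $y_0\in\mathbb R$ and each history-dependent randomized policy $\tilde u=(\tilde u_t;t\in\mathcal T)\in\tilde{\mathcal U}^{\rm HR}$ of the augmented MDP $\widetilde{\mathcal M}$, there exists a history-dependent randomized policy $u=(u_t;t\in\mathcal T)\in\mathcal U^{\rm HR}$ of the original MDP such that $$\hat J_0^{u}(s_0,y_0)=V_0^{\tilde u}(s_0,y_0),\qquad\forall s_0\in\mathcal S.$$ Further, $$\hat J_0^{*}(s_0,y_0)=V_0^{*}(s_0,y_0),\qquad\forall (s_0,y_0)\in\mathcal S\times\mathbb R .$$
   Context: Original MDP. $\mathcal T=\{0,1,\ldots,T-1\}$ with $T<\infty$; $\mathcal S,\mathcal A$ are finite state and action spaces; $\mathcal A(s)\subset\mathcal A$ is the (nonempty) set of admissible actions at $s$, with $\cup_s\mathcal A(s)=\mathcal A$; $\mathcal K=\{(s,a):s\in\mathcal S,a\in\mathcal A(s)\}$; $P_t(\cdot|s,a)$ is a transition probability on $\mathcal S$ for each $(s,a)\in\mathcal K$, $t\in\mathcal T$; $r_t:\mathcal K\to\mathbb R$ is the reward function. A history-dependent randomized policy $u=(u_t;t\in\mathcal T)\in\mathcal U^{\rm HR}$ consists of kernels $u_t(\cdot|h_t)$, probability distributions on $\mathcal A(s_t)$ given the history $h_t=(s_0,a_0,\ldots,s_{t-1},a_{t-1},s_t)$. $\mathbb E^u_{s_0}$ is the expectation under $u$ with initial state $s_0$. $R_{0:T}=\sum_{\tau=0}^{T-1}r_\tau(s_\tau,a_\tau)$. The constant $\lambda\ge 0$ is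 fixed. The pseudo mean-variance is $$\hat J_0^u(s_0,y_0)=\mathbb E^u_{s_0}\big[R_{0:T}-\lambda(R_{0:T}-y_0)^2\big],\qquad \hat J_0^*(s_0,y_0)=\sup_{u\in\mathcal U^{\rm HR}}\hat J_0^u(s_0,y_0).$$ Augmented MDP $\widetilde{\mathcal M}$. Its state space is $\tilde{\mathcal S}=\mathcal S\times\mathbb R$; admissible actions at $(s,y)$ are $\mathcal A(s)$; taking action $a_t$ in state $(s_t,y_t)$ at time $t$ gives reward $r_t(s_t,a_t)$ and the next state $(s_{t+1},y_{t+1})$ with $s_{t+1}\sim P_t(\cdot|s_t,a_t)$ and $y_{t+1}=y_t-r_t(s_t,a_t)$; the terminal reward is $-\lambda y_T^2$. $\tilde{\mathcal U}^{\rm HR}$ is the set of its history-dependent randomized policies $\tilde u=(\tilde u_t)$, where $\tilde u_t$ is a probability distribution on $\mathcal A(s_t)$ given $(s_0,y_0,a_0,\ldots,s_t,y_t)$. $\mathbb E^{\tilde u}_{(s_0,y_0)}$ is the corresponding expectation and $$V_0^{\tilde u}(s_0,y_0)=\mathbb E^{\tilde u}_{(s_0,y_0)}\Big[\sum_{t=0}^{T-1}r_t(s_t,a_t)-\lambda y_T^2\Big],\qquad V_0^*(s_0,y_0)=\sup_{\tilde u\in\tilde{\mathcal U}^{\rm HR}}V_0^{\tilde u}(s_0,y_0).$$ *)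

theory Defs
  imports "HOL-Probability.Probability"
begin

text \<open>
  A history \<open>(x\<^sub>0, a\<^sub>0, ..., x\<^bsub>t-1\<^esub>, a\<^bsub>t-1\<^esub>, x\<^sub>t)\<close> is encoded as
  \<open>([(x\<^sub>0, a\<^sub>0), ..., (x\<^bsub>t-1\<^esub>, a\<^bsub>t-1\<^esub>)], x\<^sub>t)\<close>. The notions up to \<open>total_reward\<close> are for an
  arbitrary state type, since they are used both for the original MDP (states \<^typ>\<open>'s\<close>) and for
  the augmented one (states \<^typ>\<open>'s \<times> real\<close>).
\<close>

type_synonym ('x, 'a) history = "('x \<times> 'a) list \<times> 'x"

type_synonym ('x, 'a) policy = "nat \<Rightarrow> ('x, 'a) history \<Rightarrow> 'a pmf"

definition histories :: "('x \<Rightarrow> 'a set) \<Rightarrow> nat \<Rightarrow> ('x, 'a) history set" where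
  "histories A t = {(ps, x). length ps = t \<and> (\<forall>(z, a) \<in> set ps. a \<in> A z)}"

text \<open>
  Policies are total functions; their values at times \<open>t \<ge> T\<close> and off the admissible histories
  are unconstrained and play no role below.
\<close>

definition HR_policies :: "('x \<Rightarrow> 'a set) \<Rightarrow> nat \<Rightarrow> ('x, 'a) policy set" where
  "HR_policies A T = {u. \<forall>t<T. \<forall>h \<in> histories A t. set_pmf (u t h) \<subseteq> A (snd h)}"

text \<open>
  The law of the history at time \<open>t\<close> under policy \<open>u\<close>, transition kernels \<open>P\<close> and initial
  state \<open>x0\<close>.
\<close>

primrec history_pmf ::
  "(nat \<Rightarrow> 'x \<Rightarrow> 'a \<Rightarrow> 'x pmf) \<Rightarrow> ('x, 'a) policy \<Rightarrow> 'x \<Rightarrow> nat \<Rightarrow> ('x, 'a) history pmf" where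
  "history_pmf P u x0 0 = return_pmf ([], x0)"
| "history_pmf P u x0 (Suc t) =
     bind_pmf (history_pmf P u x0 t) (\<lambda>(ps, x).
       bind_pmf (u t (ps, x)) (\<lambda>a.
         map_pmf (\<lambda>x'. (ps @ [(x, a)], x')) (P t x a)))"

definition total_reward :: "(nat \<Rightarrow> 'x \<Rightarrow> 'a \<Rightarrow> real) \<Rightarrow> nat \<Rightarrow> ('x, 'a) history \<Rightarrow> real" where
  "total_reward r T h = (\<Sum>t<T. r t (fst (fst h ! t)) (snd (fst h ! t)))"

definition pseudo_mv ::
  "(nat \<Rightarrow> 's \<Rightarrow> 'a \<Rightarrow> 's pmf) \<Rightarrow> (nat \<Rightarrow> 's \<Rightarrow> 'a \<Rightarrow> real) \<Rightarrow> real \<Rightarrow> nat \<Rightarrow>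
    ('s, 'a) policy \<Rightarrow> 's \<Rightarrow> real \<Rightarrow> real" where
  "pseudo_mv P r lam T u s0 y0 =
     measure_pmf.expectation (history_pmf P u s0 T)
       (\<lambda>h. total_reward r T h - lam * (total_reward r T h - y0)\<^sup>2)"

text \<open>
  The suprema here and in \<open>aug_opt_value\<close> are taken in \<^typ>\<open>real\<close>. For finite state and action
  types, \<open>lam \<ge> 0\<close> and nonempty \<open>A s\<close> they range over nonempty sets that are bounded above by
  a bound on the total reward.
\<close>

definition pseudo_mv_opt ::
  "('s \<Rightarrow> 'a set) \<Rightarrow> (nat \<Rightarrow> 's \<Rightarrow> 'a \<Rightarrow> 's pmf) \<Rightarrow> (nat \<Rightarrow> 's \<Rightarrow> 'a \<Rightarrow> real) \<Rightarrow> real \<Rightarrow> nat \<Rightarrow>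
    's \<Rightarrow> real \<Rightarrow> real" where
  "pseudo_mv_opt A P r lam T s0 y0 = (SUP u \<in> HR_policies A T. pseudo_mv P r lam T u s0 y0)"

definition aug_actions :: "('s \<Rightarrow> 'a set) \<Rightarrow> 's \<times> real \<Rightarrow> 'a set" where
  "aug_actions A = (\<lambda>(s, y). A s)"

definition aug_kernel ::
  "(nat \<Rightarrow> 's \<Rightarrow> 'a \<Rightarrow> 's pmf) \<Rightarrow> (nat \<Rightarrow> 's \<Rightarrow> 'a \<Rightarrow> real) \<Rightarrow>
    nat \<Rightarrow> 's \<times> real \<Rightarrow> 'a \<Rightarrow> ('s \<times> real) pmf" where
  "aug_kernel P r t = (\<lambda>(s, y) a. map_pmf (\<lambda>s'. (s', y - r t s a)) (P t s a))"

definition aug_reward ::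
  "(nat \<Rightarrow> 's \<Rightarrow> 'a \<Rightarrow> real) \<Rightarrow> nat \<Rightarrow> 's \<times> real \<Rightarrow> 'a \<Rightarrow> real" where
  "aug_reward r t = (\<lambda>(s, y) a. r t s a)"

definition aug_value ::
  "(nat \<Rightarrow> 's \<Rightarrow> 'a \<Rightarrow> 's pmf) \<Rightarrow> (nat \<Rightarrow> 's \<Rightarrow> 'a \<Rightarrow> real) \<Rightarrow> real \<Rightarrow> nat \<Rightarrow>
    ('s \<times> real, 'a) policy \<Rightarrow> 's \<Rightarrow> real \<Rightarrow> real" where
  "aug_value P r lam T v s0 y0 =
     measure_pmf.expectation (history_pmf (aug_kernel P r) v (s0, y0) T)
       (\<lambda>h. total_reward (aug_reward r) T h - lam * (snd (snd h))\<^sup>2)"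

definition aug_opt_value ::
  "('s \<Rightarrow> 'a set) \<Rightarrow> (nat \<Rightarrow> 's \<Rightarrow> 'a \<Rightarrow> 's pmf) \<Rightarrow> (nat \<Rightarrow> 's \<Rightarrow> 'a \<Rightarrow> real) \<Rightarrow> real \<Rightarrow> nat \<Rightarrow>
    's \<Rightarrow> real \<Rightarrow> real" where
  "aug_opt_value A P r lam T s0 y0 =
     (SUP v \<in> HR_policies (aug_actions A) T. aug_value P r lam T v s0 y0)"

end

theory Submission imports Defs begin

text \<open>
  The second component of the augmented state is a function of the original history, namely \<open>y0\<close>
  minus the reward collected so far. Inserting it is therefore an injection of original histories
  into augmented ones, which transports the history law of a policy \<open>u\<close> to that of a policy \<open>v\<close>
  as soon as \<open>u\<close> is \<open>v\<close> composed with this injection. Every \<open>v\<close> induces such a \<open>u\<close>, and every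
  \<open>u\<close> arises from the \<open>v\<close> that ignores the second component, so both problems attain the same
  values.
\<close>

text \<open>\<open>total_reward r t h\<close> reads only the first \<open>t\<close> pairs of
  \<open>h\<close>, so the whole of \<open>h\<close> can be passed where the prefix up to time
  \<open>t\<close> is meant.\<close>

definition augment_history ::
  "(nat \<Rightarrow> 's \<Rightarrow> 'a \<Rightarrow> real) \<Rightarrow> real \<Rightarrow> ('s, 'a) history \<Rightarrow> ('s \<times> real, 'a) history" where
  "augment_history r y0 h =
     (map (\<lambda>t. ((fst (fst h ! t), y0 - total_reward r t h), snd (fst h ! t))) [0..<length (fst h)],
      (snd h, y0 - total_reward r (length (fst h)) h))"

text \<open>Only a left inverse of \<open>augment_history r y0\<close>: the real components of an
  arbitrary augmented history need not match its rewards.\<close>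

definition forget_history :: "('s \<times> real, 'a) history \<Rightarrow> ('s, 'a) history" where
  "forget_history h = (map (\<lambda>((s, y), a). (s, a)) (fst h), fst (snd h))"

lemma forget_augment_history [simp]: "forget_history (augment_history r y0 h) = h"
  by (cases h) (auto simp: forget_history_def augment_history_def intro!: nth_equalityI)

lemma augment_history_in_histories:
  assumes "h \<in> histories A t"
  shows "augment_history r y0 h \<in> histories (aug_actions A) t"
proof -
  have "snd (fst h ! i) \<in> A (fst (fst h ! i))" if "i < t" for i
    using assms nth_mem[of i "fst h"] that
    by (auto simp: histories_def split_beta)
  then show ?thesis
    using assms by (auto simp: histories_def augment_history_def aug_actions_def)
qed

lemma forget_history_in_histories:
  assumes "h \<in> histories (aug_actions A) t"
  shows "forget_history h \<in> histories A t"
  using assms by (fastforce simp: histories_def forget_history_def aug_actions_def)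

lemma augment_policy_in_HR_policies:
  assumes "u \<in> HR_policies A T"
  shows "(\<lambda>t h. u t (forget_history h)) \<in> HR_policies (aug_actions A) T"
  unfolding HR_policies_def
proof (intro CollectI allI impI ballI)
  fix t h assume "t < T" "h \<in> histories (aug_actions A) t"
  then have "set_pmf (u t (forget_history h)) \<subseteq> A (snd (forget_history h))"
    using assms forget_history_in_histories unfolding HR_policies_def by blast
  then show "set_pmf (u t (forget_history h)) \<subseteq> aug_actions A (snd h)"
    by (simp add: forget_history_def aug_actions_def split_beta)
qed

lemma restrict_policy_in_HR_policies:
  assumes "v \<in> HR_policies (aug_actions A) T"
  shows "(\<lambda>t h. v t (augment_history r y0 h)) \<in> HR_policies A T"
  unfolding HR_policies_def
proof (intro CollectI allI impI ballI)
  fix t h assume "t < T" "h \<in> histories A t"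
  then have "set_pmf (v t (augment_history r y0 h)) \<subseteq> aug_actions A (snd (augment_history r y0 h))"
    using assms augment_history_in_histories unfolding HR_policies_def by blast
  then show "set_pmf (v t (augment_history r y0 h)) \<subseteq> A (snd h)"
    by (simp add: augment_history_def aug_actions_def)
qed

lemma length_history_pmf:
  "h \<in> set_pmf (history_pmf P u x0 t) \<Longrightarrow> length (fst h) = t"
  by (induction t arbitrary: h) auto

text \<open>Appending a pair leaves the rewards of earlier prefixes unchanged, so only the last
  state is new, and it follows the update rule of \<open>aug_kernel\<close>.\<close>

lemma augment_history_snoc:
  "augment_history r y0 (ps @ [(x, a)], x') =
     (fst (augment_history r y0 (ps, x)) @ [(snd (augment_history r y0 (ps, x)), a)],
      (x', snd (snd (augment_history r y0 (ps, x))) - r (length ps) x a))"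
proof -
  have "total_reward r t (ps @ [(x, a)], x') = total_reward r t (ps, x)" if "t \<le> length ps" for t
    using that by (auto simp: total_reward_def nth_append intro!: sum.cong)
  then show ?thesis
    by (auto simp: augment_history_def nth_append total_reward_def)
qed

text \<open>Induction on time: by \<open>uv\<close> both processes draw the action from the same
  law, and the only further randomness in \<open>aug_kernel\<close> is the next original
  state.\<close>

lemma history_pmf_aug_kernel:
  assumes uv: "\<And>t h. u t h = v t (augment_history r y0 h)"
  shows "history_pmf (aug_kernel P r) v (s0, y0) t =
         map_pmf (augment_history r y0) (history_pmf P u s0 t)"
proof (induction t)
  case 0
  show ?case by (simp add: augment_history_def total_reward_def)
next
  case (Suc t)
  let ?f = "augment_history r y0"
  have "history_pmf (aug_kernel P r) v (s0, y0) (Suc t) =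
        bind_pmf (history_pmf P u s0 t) (\<lambda>h. bind_pmf (v t (?f h)) (\<lambda>a.
          map_pmf (\<lambda>z. (fst (?f h) @ [(snd (?f h), a)], z)) (aug_kernel P r t (snd (?f h)) a)))"
    by (simp add: Suc.IH bind_map_pmf split_beta)
  also have "\<dots> = bind_pmf (history_pmf P u s0 t) (\<lambda>h. bind_pmf (u t h) (\<lambda>a.
          map_pmf (\<lambda>x'. ?f (fst h @ [(snd h, a)], x')) (P t (snd h) a)))"
  proof (intro bind_pmf_cong refl)
    \<comment> \<open>The kernel subtracts the reward of time \<open>t\<close>, the snoc lemma that
      of time \<open>length (fst h)\<close>; the two agree on the support.\<close>
    fix h a assume "h \<in> set_pmf (history_pmf P u s0 t)"
    then have "length (fst h) = t" by (rule length_history_pmf)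
    moreover have "fst (snd (?f h)) = snd h" by (simp add: augment_history_def)
    ultimately show "map_pmf (\<lambda>z. (fst (?f h) @ [(snd (?f h), a)], z))
        (aug_kernel P r t (snd (?f h)) a) =
      map_pmf (\<lambda>x'. ?f (fst h @ [(snd h, a)], x')) (P t (snd h) a)"
      by (simp add: augment_history_snoc aug_kernel_def split_beta map_pmf_comp)
  qed (simp add: uv)
  also have "\<dots> = map_pmf ?f (history_pmf P u s0 (Suc t))"
    by (simp add: map_bind_pmf map_pmf_comp split_beta)
  finally show ?case .
qed

text \<open>The final real component is \<open>y0\<close> minus the total reward, so its square is
  the penalty in \<open>pseudo_mv\<close>.\<close>

lemma pseudo_mv_eq_aug_value:
  assumes "\<And>t h. u t h = v t (augment_history r y0 h)"
  shows "pseudo_mv P r lam T u s0 y0 = aug_value P r lam T v s0 y0"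
proof -
  let ?f = "augment_history r y0"
  have "aug_value P r lam T v s0 y0 = measure_pmf.expectation (history_pmf P u s0 T)
      (\<lambda>h. total_reward (aug_reward r) T (?f h) - lam * (snd (snd (?f h)))\<^sup>2)"
    by (simp add: aug_value_def history_pmf_aug_kernel[of u v r y0, OF assms])
  also have "\<dots> = pseudo_mv P r lam T u s0 y0"
    unfolding pseudo_mv_def
  \<comment> \<open>The integrands are compared only on the support, where histories have length
    \<open>T\<close>.\<close>
  proof (intro integral_cong_AE AE_pmfI)
    fix h assume "h \<in> set_pmf (history_pmf P u s0 T)"
    then have len: "length (fst h) = T" by (rule length_history_pmf)
    then have "total_reward (aug_reward r) T (?f h) = total_reward r T h"
      by (auto simp: total_reward_def augment_history_def aug_reward_def)
    with len show "total_reward (aug_reward r) T (?f h) - lam * (snd (snd (?f h)))\<^sup>2 =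
        total_reward r T h - lam * (total_reward r T h - y0)\<^sup>2"
      by (simp add: augment_history_def power2_commute)
  qed auto
  finally show ?thesis by simp
qed

theorem theorem1:
  fixes T :: nat
    and A :: "'s::finite \<Rightarrow> 'a::finite set"
    and P :: "nat \<Rightarrow> 's \<Rightarrow> 'a \<Rightarrow> 's pmf"
    and r :: "nat \<Rightarrow> 's \<Rightarrow> 'a \<Rightarrow> real"
    and lam :: real
  assumes "\<And>s. A s \<noteq> {}"
    and "(\<Union>s. A s) = UNIV"
    and "lam \<ge> 0"
  shows "(\<forall>y0. \<forall>v \<in> HR_policies (aug_actions A) T. \<exists>u \<in> HR_policies A T. \<forall>s0.
            pseudo_mv P r lam T u s0 y0 = aug_value P r lam T v s0 y0)
       \<and> (\<forall>s0 y0. pseudo_mv_opt A P r lam T s0 y0 = aug_opt_value A P r lam T s0 y0)"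
proof -
  have restrict: "\<exists>u \<in> HR_policies A T. \<forall>s0.
      pseudo_mv P r lam T u s0 y0 = aug_value P r lam T v s0 y0"
    if "v \<in> HR_policies (aug_actions A) T" for v y0
  proof (intro bexI allI)
    \<comment> \<open>The witness depends on \<open>y0\<close> but not on \<open>s0\<close>, so one
      policy serves all initial states.\<close>
    show "pseudo_mv P r lam T (\<lambda>t h. v t (augment_history r y0 h)) s0 y0 =
        aug_value P r lam T v s0 y0" for s0
      by (rule pseudo_mv_eq_aug_value) simp
  qed (rule restrict_policy_in_HR_policies[OF that])
  have augment: "\<exists>v \<in> HR_policies (aug_actions A) T.
      pseudo_mv P r lam T u s0 y0 = aug_value P r lam T v s0 y0"
    if "u \<in> HR_policies A T" for u s0 y0
  proof (intro bexI)
    show "pseudo_mv P r lam T u s0 y0 = aug_value P r lam T (\<lambda>t h. u t (forget_history h)) s0 y0"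
      by (rule pseudo_mv_eq_aug_value) simp
  qed (rule augment_policy_in_HR_policies[OF that])
  \<comment> \<open>The suprema agree because they are taken over the same set of values.\<close>
  have "(\<lambda>u. pseudo_mv P r lam T u s0 y0) ` HR_policies A T =
      (\<lambda>v. aug_value P r lam T v s0 y0) ` HR_policies (aug_actions A) T" for s0 y0
  proof (intro equalityI image_subsetI)
    fix u assume "u \<in> HR_policies A T"
    from augment[OF this] show "pseudo_mv P r lam T u s0 y0 \<in>
        (\<lambda>v. aug_value P r lam T v s0 y0) ` HR_policies (aug_actions A) T"
      by (rule bexE) (auto intro: image_eqI)
  next
    fix v assume "v \<in> HR_policies (aug_actions A) T"
    from restrict[OF this, of y0] obtain u where "u \<in> HR_policies A T"
      "pseudo_mv P r lam T u s0 y0 = aug_value P r lam T v s0 y0" by blast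
    then show "aug_value P r lam T v s0 y0 \<in>
        (\<lambda>u. pseudo_mv P r lam T u s0 y0) ` HR_policies A T"
      by (metis image_eqI)
  qed
  then show ?thesis
    using restrict by (simp add: pseudo_mv_opt_def aug_opt_value_def)
qed

end
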